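(* Let $\Theta$ be a state-rendering map. Then the assignment $\star$ sending a trace-preserving linear map $\mathcal{E}:\mathcal{A}\to\mathcal{B}$ between multi-matrix algebras and a state $\rho\in\mathcal{S}(\mathcal{A})$ to $$\mathcal{E}\star\rho:=(\Theta_{\rho}\otimes\mathrm{id}_{\mathcal{B}})(\mathscr{D}[\mathcal{E}])\in\mathcal{A}\otimes\mathcal{B}$$ defines an (extended) state over time function that is process-linear and satisfies the classical limit axiom.
   Context: A multi-matrix algebra is a finite direct sum $\mathcal{A}=\bigoplus_{x\in X}\mathbb{M}_{m_x}$ of complex matrix algebras ($X$ a finite set, $m_x$ positive integers), with componentwise multiplication and componentwise conjugate transpose $\dagger$; $1_{\mathcal{A}}$ is its unit and $\mathrm{tr}(A)=\sum_x\mathrm{tr}(A_x)$ its (un-normalized) trace. A state is a positive element of trace $1$; $\mathcal{S}(\mathcal{A})$ is the set of states. $\mathrm{TP}(\mathcal{A},\mathcal{B})$ is the set of trace-preserving linear maps $\mathcal{A}\to\mathcal{B}$. The Hilbert–Schmidt inner product is $\langle A,A'\rangle=\mathrm{tr}(A^{\dagger}A')$, and the Hilbert–Schmidt adjoint $\Phi^*$ of a linear map $\Phi:\mathcal{A}\to\mathcal{B}$ is defined by $\mathrm{tr}(\Phi(A)^{\dagger}B)=\mathrm{tr}(A^{\dagger}\Phi^*(B))$. Let $\mu_{\mathcal{A}}:\mathcal{A}\otimes\mathcal{A}\to\mathcal{A}$ be the multiplication map. The channel state of a linear map $\Phi:\mathcal{A}\to\mathcal{B}$ is $\mathscr{D}[\Phi]=(\mathrm{id}_{\mathcal{A}}\otimes\Phi)(\mu_{\mathcal{A}}^*(1_{\mathcal{A}}))\in\mathcal{A}\otimes\mathcal{B}$.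 A state-rendering map $\Theta$ assigns to every multi-matrix algebra $\mathcal{A}$ and every state $\rho\in\mathcal{S}(\mathcal{A})$ a linear map $\Theta_{\rho}:\mathcal{A}\to\mathcal{A}$ such that: (T1) $\Theta_{\rho}(A)=\rho A$ whenever $A\in\mathcal{A}$ satisfies $[\rho,A]=0$; (T2) $\Theta_{\rho}\circ\mathcal{E}^{-1}=\mathcal{E}^{-1}\circ\Theta_{\mathcal{E}(\rho)}$ whenever $\mathcal{E}:\mathcal{A}\to\mathcal{B}$ is a $*$-isomorphism and $\rho\in\mathcal{S}(\mathcal{A})$; (T3) for multi-matrix algebras $\mathcal{A},\mathcal{A}'$, $\Theta_{\rho\otimes\rho'}=\Theta_{\rho}\otimes\Theta_{\rho'}$ for all $\rho\in\mathcal{S}(\mathcal{A})$, $\rho'\in\mathcal{S}(\mathcal{A}')$ such that at least one of $\rho$, $\rho'$ is in the center of $\mathcal{A}$, $\mathcal{A}'$, respectively; (T4) $\Theta_{\rho}$ is self-adjoint and positive semi-definite with respect to the Hilbert–Schmidt inner product. An (extended) state over time function $\star$ associates to every pair $(\mathcal{A},\mathcal{B})$ of multi-matrix algebras a map $\mathrm{TP}(\mathcal{A},\mathcal{B})\times\mathcal{S}(\mathcal{A})\to\mathcal{A}\otimes\mathcal{B}$, $(\mathcal{E},\rho)\mapsto\mathcal{E}\star\rho$, with $\mathrm{tr}_{\mathcal{B}}(\mathcal{E}\star\rho)=\rho$ and $\mathrm{tr}_{\mathcal{A}}(\mathcal{E}\star\rho)=\mathcal{E}(\rho)$, where $\mathrm{tr}_{\mathcal{B}}:\mathcal{A}\otimes\mathcal{B}\to\mathcal{A}$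 and $\mathrm{tr}_{\mathcal{A}}:\mathcal{A}\otimes\mathcal{B}\to\mathcal{B}$ are the partial traces. It is process-linear iff $(\lambda\mathcal{E}+(1-\lambda)\mathcal{F})\star\rho=\lambda\,\mathcal{E}\star\rho+(1-\lambda)\,\mathcal{F}\star\rho$ for all $\lambda\in\mathbb{C}$, $\rho\in\mathcal{S}(\mathcal{A})$, $\mathcal{E},\mathcal{F}\in\mathrm{TP}(\mathcal{A},\mathcal{B})$. It satisfies the classical limit axiom iff, for all $\rho\in\mathcal{S}(\mathcal{A})$ and $\mathcal{E}\in\mathrm{TP}(\mathcal{A},\mathcal{B})$, $[\mathscr{D}[\mathcal{E}],\rho\otimes1_{\mathcal{B}}]=0$ implies $\mathcal{E}\star\rho=\mathscr{D}[\mathcal{E}](\rho\otimes 1_{\mathcal{B}})$. *)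

theory Defs
  imports
    "HOL-Library.FuncSet"
    "HOL-Library.Complex_Order"
    "Jordan_Normal_Form.Matrix"
    "Jordan_Normal_Form.Schur_Decomposition"
begin

section \<open>Multi-matrix algebras\<close>

text \<open>
  The direct sum of the complex matrix algebras of sizes m_0, ..., m_{k-1} is represented by the
  list of its block sizes; the finite index set is the set of list positions.  An element is
  the list of its blocks.
\<close>

type_synonym algebra = "nat list"
type_synonym element = "complex mat list"

definition multi_matrix_algebra :: "algebra \<Rightarrow> bool" where
  "multi_matrix_algebra \<A> \<longleftrightarrow> (\<forall>m\<in>set \<A>. 0 < m)"

definition elements :: "algebra \<Rightarrow> element set" where
  "elements \<A> = {A. length A = length \<A> \<and> (\<forall>x<length \<A>. A ! x \<in> carrier_mat (\<A> ! x) (\<A> ! x))}"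

definition mm_zero :: "algebra \<Rightarrow> element" where
  "mm_zero \<A> = map (\<lambda>m. 0\<^sub>m m m) \<A>"

definition mm_one :: "algebra \<Rightarrow> element" where
  "mm_one \<A> = map 1\<^sub>m \<A>"

definition mm_add :: "element \<Rightarrow> element \<Rightarrow> element" (infixl "\<oplus>\<^sub>M" 65) where
  "A \<oplus>\<^sub>M B = map2 (+) A B"

definition mm_scale :: "complex \<Rightarrow> element \<Rightarrow> element" (infixr "\<odot>\<^sub>M" 75) where
  "c \<odot>\<^sub>M A = map (\<lambda>M. c \<cdot>\<^sub>m M) A"

definition mm_mult :: "element \<Rightarrow> element \<Rightarrow> element" (infixl "\<bullet>\<^sub>M" 70) where
  "A \<bullet>\<^sub>M B = map2 (*) A B"

definition mm_dagger :: "element \<Rightarrow> element" where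
  "mm_dagger A = map mat_adjoint A"

definition mm_commutator :: "element \<Rightarrow> element \<Rightarrow> element" where
  "mm_commutator A B = map2 (-) (A \<bullet>\<^sub>M B) (B \<bullet>\<^sub>M A)"

definition mm_trace :: "element \<Rightarrow> complex" where
  "mm_trace A = (\<Sum>M\<leftarrow>A. \<Sum>i<dim_row M. M $$ (i, i))"

definition hs_inner :: "element \<Rightarrow> element \<Rightarrow> complex" where
  "hs_inner A B = mm_trace (mm_dagger A \<bullet>\<^sub>M B)"

definition mm_center :: "algebra \<Rightarrow> element set" where
  "mm_center \<A> = {Z \<in> elements \<A>. \<forall>A\<in>elements \<A>. Z \<bullet>\<^sub>M A = A \<bullet>\<^sub>M Z}"

definition mm_positive :: "algebra \<Rightarrow> element \<Rightarrow> bool" where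
  "mm_positive \<A> A \<longleftrightarrow> (\<exists>C\<in>elements \<A>. A = mm_dagger C \<bullet>\<^sub>M C)"

definition states :: "algebra \<Rightarrow> element set" where
  "states \<A> = {\<rho> \<in> elements \<A>. mm_positive \<A> \<rho> \<and> mm_trace \<rho> = 1}"


section \<open>Linear maps\<close>

text \<open>Maps are extensional, so that equality of maps is equality on the domain algebra.\<close>

definition linear_maps :: "algebra \<Rightarrow> algebra \<Rightarrow> (element \<Rightarrow> element) set" where
  "linear_maps \<A> \<B> = {\<Phi> \<in> elements \<A> \<rightarrow>\<^sub>E elements \<B>.
     (\<forall>A\<in>elements \<A>. \<forall>A'\<in>elements \<A>. \<Phi> (A \<oplus>\<^sub>M A') = \<Phi> A \<oplus>\<^sub>M \<Phi> A') \<and>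
     (\<forall>c. \<forall>A\<in>elements \<A>. \<Phi> (c \<odot>\<^sub>M A) = c \<odot>\<^sub>M \<Phi> A)}"

definition id_map :: "algebra \<Rightarrow> element \<Rightarrow> element" where
  "id_map \<A> = (\<lambda>A\<in>elements \<A>. A)"

definition affine_comb ::
  "algebra \<Rightarrow> complex \<Rightarrow> (element \<Rightarrow> element) \<Rightarrow> (element \<Rightarrow> element) \<Rightarrow> element \<Rightarrow> element" where
  "affine_comb \<A> c \<Phi> \<Psi> = (\<lambda>A\<in>elements \<A>. c \<odot>\<^sub>M \<Phi> A \<oplus>\<^sub>M (1 - c) \<odot>\<^sub>M \<Psi> A)"

definition TP :: "algebra \<Rightarrow> algebra \<Rightarrow> (element \<Rightarrow> element) set" where
  "TP \<A> \<B> = {\<Phi> \<in> linear_maps \<A> \<B>. \<forall>A\<in>elements \<A>. mm_trace (\<Phi> A) = mm_trace A}"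

definition star_isos :: "algebra \<Rightarrow> algebra \<Rightarrow> (element \<Rightarrow> element) set" where
  "star_isos \<A> \<B> = {\<Phi> \<in> linear_maps \<A> \<B>.
     bij_betw \<Phi> (elements \<A>) (elements \<B>) \<and>
     (\<forall>A\<in>elements \<A>. \<forall>A'\<in>elements \<A>. \<Phi> (A \<bullet>\<^sub>M A') = \<Phi> A \<bullet>\<^sub>M \<Phi> A') \<and>
     (\<forall>A\<in>elements \<A>. \<Phi> (mm_dagger A) = mm_dagger (\<Phi> A))}"

definition inverse_map :: "algebra \<Rightarrow> algebra \<Rightarrow> (element \<Rightarrow> element) \<Rightarrow> element \<Rightarrow> element" where
  "inverse_map \<A> \<B> \<Phi> = (\<lambda>B\<in>elements \<B>. the_inv_into (elements \<A>) \<Phi> B)"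

definition hs_adjoint :: "algebra \<Rightarrow> algebra \<Rightarrow> (element \<Rightarrow> element) \<Rightarrow> element \<Rightarrow> element" where
  "hs_adjoint \<A> \<B> \<Phi> = (\<lambda>B\<in>elements \<B>.
     THE C. C \<in> elements \<A> \<and> (\<forall>A\<in>elements \<A>. hs_inner (\<Phi> A) B = hs_inner A C))"


section \<open>Tensor products\<close>

text \<open>
  The blocks of the tensor product are the tensor products of blocks, in lexicographic order;
  a tensor product of two full matrix algebras is identified with a full matrix algebra through
  the Kronecker product.
\<close>

definition kronecker :: "complex mat \<Rightarrow> complex mat \<Rightarrow> complex mat" where
  "kronecker P Q = mat (dim_row P * dim_row Q) (dim_col P * dim_col Q)
     (\<lambda>(i, j). P $$ (i div dim_row Q, j div dim_col Q) * Q $$ (i mod dim_row Q, j mod dim_col Q))"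

definition tensor_algebra :: "algebra \<Rightarrow> algebra \<Rightarrow> algebra" (infixr "\<otimes>\<^sub>A" 72) where
  "\<A> \<otimes>\<^sub>A \<B> = map (\<lambda>(m, n). m * n) (List.product \<A> \<B>)"

definition tensor :: "element \<Rightarrow> element \<Rightarrow> element" (infixr "\<otimes>\<^sub>M" 72) where
  "A \<otimes>\<^sub>M B = map (\<lambda>(P, Q). kronecker P Q) (List.product A B)"

text \<open>Matrix units are labelled by triples consisting of block, row and column.\<close>

definition units :: "algebra \<Rightarrow> (nat \<times> nat \<times> nat) set" where
  "units \<A> = {(x, i, j). x < length \<A> \<and> i < \<A> ! x \<and> j < \<A> ! x}"

definition coefficient :: "element \<Rightarrow> nat \<times> nat \<times> nat \<Rightarrow> complex" where
  "coefficient A = (\<lambda>(x, i, j). A ! x $$ (i, j))"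

definition from_coefficients :: "algebra \<Rightarrow> (nat \<times> nat \<times> nat \<Rightarrow> complex) \<Rightarrow> element" where
  "from_coefficients \<A> f =
     map (\<lambda>x. mat (\<A> ! x) (\<A> ! x) (\<lambda>(i, j). f (x, i, j))) [0..<length \<A>]"

definition matrix_unit :: "algebra \<Rightarrow> nat \<times> nat \<times> nat \<Rightarrow> element" where
  "matrix_unit \<A> u = from_coefficients \<A> (\<lambda>v. if v = u then 1 else 0)"

definition pair_unit ::
  "algebra \<Rightarrow> algebra \<Rightarrow> nat \<times> nat \<times> nat \<Rightarrow> nat \<times> nat \<times> nat \<Rightarrow> nat \<times> nat \<times> nat" where
  "pair_unit \<A> \<B> = (\<lambda>(x, i, j) (y, k, l).
     (x * length \<B> + y, i * \<B> ! y + k, j * \<B> ! y + l))"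

text \<open>
  The linear map on the tensor product of \<open>\<A>\<close> and \<open>\<B>\<close> induced by a bilinear map
  \<open>\<beta>\<close> into \<open>\<C>\<close>, obtained by expanding the argument in the matrix units
  \<open>e\<^sub>u \<otimes> e\<^sub>v = e\<^bsub>pair_unit u v\<^esub>\<close>.  It is the linear map that sends
  \<open>A \<otimes> B\<close> to \<open>\<beta> A B\<close>.
\<close>

definition tensor_lift ::
  "algebra \<Rightarrow> algebra \<Rightarrow> algebra \<Rightarrow> (element \<Rightarrow> element \<Rightarrow> element) \<Rightarrow> element \<Rightarrow> element" where
  "tensor_lift \<A> \<B> \<C> \<beta> = (\<lambda>Z\<in>elements (\<A> \<otimes>\<^sub>A \<B>).
     from_coefficients \<C> (\<lambda>w. \<Sum>u\<in>units \<A>. \<Sum>v\<in>units \<B>.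
       coefficient Z (pair_unit \<A> \<B> u v) *
       coefficient (\<beta> (matrix_unit \<A> u) (matrix_unit \<B> v)) w))"

text \<open>The arguments are ordered for maps \<open>\<Phi> : \<A> \<rightarrow> \<C>\<close> and \<open>\<Psi> : \<B> \<rightarrow> \<D>\<close>.\<close>

definition tensor_map ::
  "algebra \<Rightarrow> algebra \<Rightarrow> algebra \<Rightarrow> algebra \<Rightarrow>
   (element \<Rightarrow> element) \<Rightarrow> (element \<Rightarrow> element) \<Rightarrow> element \<Rightarrow> element" where
  "tensor_map \<A> \<B> \<C> \<D> \<Phi> \<Psi> = tensor_lift \<A> \<B> (\<C> \<otimes>\<^sub>A \<D>) (\<lambda>A B. \<Phi> A \<otimes>\<^sub>M \<Psi> B)"

definition mult_map :: "algebra \<Rightarrow> element \<Rightarrow> element" where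
  "mult_map \<A> = tensor_lift \<A> \<A> \<A> (\<lambda>A A'. A \<bullet>\<^sub>M A')"

text \<open>\<open>partial_trace_right\<close> traces out the right factor \<open>\<B>\<close>, \<open>partial_trace_left\<close> the left factor \<open>\<A>\<close>.\<close>

definition partial_trace_right :: "algebra \<Rightarrow> algebra \<Rightarrow> element \<Rightarrow> element" where
  "partial_trace_right \<A> \<B> = tensor_lift \<A> \<B> \<A> (\<lambda>A B. mm_trace B \<odot>\<^sub>M A)"

definition partial_trace_left :: "algebra \<Rightarrow> algebra \<Rightarrow> element \<Rightarrow> element" where
  "partial_trace_left \<A> \<B> = tensor_lift \<A> \<B> \<B> (\<lambda>A B. mm_trace A \<odot>\<^sub>M B)"

definition channel_state :: "algebra \<Rightarrow> algebra \<Rightarrow> (element \<Rightarrow> element) \<Rightarrow> element" where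
  "channel_state \<A> \<B> \<Phi> =
     tensor_map \<A> \<A> \<A> \<B> (id_map \<A>) \<Phi> (hs_adjoint (\<A> \<otimes>\<^sub>A \<A>) \<A> (mult_map \<A>) (mm_one \<A>))"


section \<open>State-rendering maps\<close>

definition hs_selfadjoint :: "algebra \<Rightarrow> (element \<Rightarrow> element) \<Rightarrow> bool" where
  "hs_selfadjoint \<A> \<Phi> \<longleftrightarrow>
     (\<forall>A\<in>elements \<A>. \<forall>A'\<in>elements \<A>. hs_inner (\<Phi> A) A' = hs_inner A (\<Phi> A'))"

text \<open>The order on the complex numbers makes \<open>0 \<le> z\<close> state that \<open>z\<close> is real and nonnegative.\<close>

definition hs_positive_semidefinite :: "algebra \<Rightarrow> (element \<Rightarrow> element) \<Rightarrow> bool" where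
  "hs_positive_semidefinite \<A> \<Phi> \<longleftrightarrow> (\<forall>A\<in>elements \<A>. 0 \<le> hs_inner A (\<Phi> A))"

definition state_rendering_map ::
  "(algebra \<Rightarrow> element \<Rightarrow> element \<Rightarrow> element) \<Rightarrow> bool" where
  "state_rendering_map \<Theta> \<longleftrightarrow>
     (\<forall>\<A> \<rho>. multi_matrix_algebra \<A> \<and> \<rho> \<in> states \<A> \<longrightarrow> \<Theta> \<A> \<rho> \<in> linear_maps \<A> \<A>) \<and>
     (\<forall>\<A> \<rho> A. multi_matrix_algebra \<A> \<and> \<rho> \<in> states \<A> \<and> A \<in> elements \<A> \<and>
        mm_commutator \<rho> A = mm_zero \<A> \<longrightarrow> \<Theta> \<A> \<rho> A = \<rho> \<bullet>\<^sub>M A) \<and>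
     (\<forall>\<A> \<B> \<E> \<rho>. multi_matrix_algebra \<A> \<and> multi_matrix_algebra \<B> \<and>
        \<E> \<in> star_isos \<A> \<B> \<and> \<rho> \<in> states \<A> \<longrightarrow>
        compose (elements \<B>) (\<Theta> \<A> \<rho>) (inverse_map \<A> \<B> \<E>) =
        compose (elements \<B>) (inverse_map \<A> \<B> \<E>) (\<Theta> \<B> (\<E> \<rho>))) \<and>
     (\<forall>\<A> \<A>' \<rho> \<rho>'. multi_matrix_algebra \<A> \<and> multi_matrix_algebra \<A>' \<and>
        \<rho> \<in> states \<A> \<and> \<rho>' \<in> states \<A>' \<and> (\<rho> \<in> mm_center \<A> \<or> \<rho>' \<in> mm_center \<A>') \<longrightarrow>
        \<Theta> (\<A> \<otimes>\<^sub>A \<A>') (\<rho> \<otimes>\<^sub>M \<rho>') = tensor_map \<A> \<A>' \<A> \<A>' (\<Theta> \<A> \<rho>) (\<Theta> \<A>' \<rho>')) \<and>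
     (\<forall>\<A> \<rho>. multi_matrix_algebra \<A> \<and> \<rho> \<in> states \<A> \<longrightarrow>
        hs_selfadjoint \<A> (\<Theta> \<A> \<rho>) \<and> hs_positive_semidefinite \<A> (\<Theta> \<A> \<rho>))"


section \<open>State over time functions\<close>

type_synonym sot = "algebra \<Rightarrow> algebra \<Rightarrow> (element \<Rightarrow> element) \<Rightarrow> element \<Rightarrow> element"

definition state_over_time_function :: "sot \<Rightarrow> bool" where
  "state_over_time_function S \<longleftrightarrow>
     (\<forall>\<A> \<B> \<E> \<rho>. multi_matrix_algebra \<A> \<and> multi_matrix_algebra \<B> \<and>
        \<E> \<in> TP \<A> \<B> \<and> \<rho> \<in> states \<A> \<longrightarrow>
        S \<A> \<B> \<E> \<rho> \<in> elements (\<A> \<otimes>\<^sub>A \<B>) \<and>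
        partial_trace_right \<A> \<B> (S \<A> \<B> \<E> \<rho>) = \<rho> \<and>
        partial_trace_left \<A> \<B> (S \<A> \<B> \<E> \<rho>) = \<E> \<rho>)"

definition process_linear :: "sot \<Rightarrow> bool" where
  "process_linear S \<longleftrightarrow>
     (\<forall>\<A> \<B> \<E> \<F> \<rho> c. multi_matrix_algebra \<A> \<and> multi_matrix_algebra \<B> \<and>
        \<E> \<in> TP \<A> \<B> \<and> \<F> \<in> TP \<A> \<B> \<and> \<rho> \<in> states \<A> \<longrightarrow>
        S \<A> \<B> (affine_comb \<A> c \<E> \<F>) \<rho> = c \<odot>\<^sub>M S \<A> \<B> \<E> \<rho> \<oplus>\<^sub>M (1 - c) \<odot>\<^sub>M S \<A> \<B> \<F> \<rho>)"

definition classical_limit_axiom :: "sot \<Rightarrow> bool" where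
  "classical_limit_axiom S \<longleftrightarrow>
     (\<forall>\<A> \<B> \<E> \<rho>. multi_matrix_algebra \<A> \<and> multi_matrix_algebra \<B> \<and>
        \<E> \<in> TP \<A> \<B> \<and> \<rho> \<in> states \<A> \<and>
        mm_commutator (channel_state \<A> \<B> \<E>) (\<rho> \<otimes>\<^sub>M mm_one \<B>) = mm_zero (\<A> \<otimes>\<^sub>A \<B>) \<longrightarrow>
        S \<A> \<B> \<E> \<rho> = channel_state \<A> \<B> \<E> \<bullet>\<^sub>M (\<rho> \<otimes>\<^sub>M mm_one \<B>))"

definition rendered_sot :: "(algebra \<Rightarrow> element \<Rightarrow> element \<Rightarrow> element) \<Rightarrow> sot" where
  "rendered_sot \<Theta> \<A> \<B> \<E> \<rho> = tensor_map \<A> \<B> \<A> \<B> (\<Theta> \<A> \<rho>) (id_map \<B>) (channel_state \<A> \<B> \<E>)"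

end

theory Submission
  imports Defs
begin

text \<open>
  Write \<open>e\<^sub>u\<close> for the matrix units and \<open>e\<^sub>u\<^sub>*\<close> for their adjoints.  The channel state is
  \<open>\<Sum>\<^sub>u e\<^sub>u \<otimes> \<E>(e\<^sub>u\<^sub>*)\<close>, so \<open>\<E> \<star> \<rho> = \<Sum>\<^sub>u \<Theta>\<^sub>\<rho>(e\<^sub>u) \<otimes> \<E>(e\<^sub>u\<^sub>*)\<close>, which is visibly affine in
  \<open>\<E>\<close>.  Since \<open>\<E>\<close> preserves traces, tracing out the right factor leaves
  \<open>\<Sum>\<^sub>u tr(e\<^sub>u) \<Theta>\<^sub>\<rho>(e\<^sub>u) = \<Theta>\<^sub>\<rho>(1)\<close>, which is \<open>\<rho>\<close> by (T1).  Self-adjointness of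
  \<open>\<Theta>\<^sub>\<rho>\<close> gives \<open>tr(\<Theta>\<^sub>\<rho>(A)) = \<langle>\<Theta>\<^sub>\<rho>(1), A\<rangle> = tr(\<rho> A)\<close>, so the other marginal is
  \<open>\<Sum>\<^sub>u tr(\<rho> e\<^sub>u) \<E>(e\<^sub>u\<^sub>*) = \<E>(\<rho>)\<close>.
  For the classical limit, expand the channel state in the matrix units of the right factor instead:
  it commutes with \<open>\<rho> \<otimes> 1\<close> iff each of its coefficients (its slices) commutes with \<open>\<rho>\<close>, and (T1)
  computes \<open>\<Theta>\<^sub>\<rho>\<close> on those.
\<close>

section \<open>Coordinates\<close>

text \<open>The labelling of adjoints: the adjoint of \<open>e_u\<close> is the matrix unit with
  label \<open>swap_unit u\<close>.\<close>

definition swap_unit :: "nat \<times> nat \<times> nat \<Rightarrow> nat \<times> nat \<times> nat" where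
  "swap_unit = (\<lambda>(x, i, j). (x, j, i))"

lemma swap_unit_simp [simp]: "swap_unit (x, i, j) = (x, j, i)"
  by (simp add: swap_unit_def)

lemma swap_unit_swap_unit [simp]: "swap_unit (swap_unit u) = u"
  by (cases u) simp

lemma swap_unit_in_units [simp]: "swap_unit u \<in> units \<A> \<longleftrightarrow> u \<in> units \<A>"
  by (cases u) (auto simp: units_def)

lemma units_Sigma: "units \<A> = (SIGMA x:{..<length \<A>}. {..<\<A> ! x} \<times> {..<\<A> ! x})"
  by (auto simp: units_def)

lemma mem_units: "(x, i, j) \<in> units \<A> \<longleftrightarrow> x < length \<A> \<and> i < \<A> ! x \<and> j < \<A> ! x"
  by (simp add: units_def)

lemma if_one_zero_mult: "(if P then 1 else 0) * c = (if P then c else (0 :: 'a :: semiring_1))"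
  by simp

lemma finite_units [simp]: "finite (units \<A>)"
  by (simp add: units_Sigma)

lemma sum_units:
  "(\<Sum>u\<in>units \<A>. f u) = (\<Sum>x<length \<A>. \<Sum>i<\<A> ! x. \<Sum>j<\<A> ! x. f (x, i, j))"
  unfolding units_Sigma by (simp add: sum.Sigma sum.cartesian_product case_prod_unfold)

lemma sum_units_swap: "(\<Sum>u\<in>units \<A>. f (swap_unit u)) = (\<Sum>u\<in>units \<A>. f u)"
  by (rule sum.reindex_bij_witness [of _ swap_unit swap_unit]) auto

section \<open>Coefficients of the algebra operations\<close>

lemma elements_length: "A \<in> elements \<A> \<Longrightarrow> length A = length \<A>"
  by (simp add: elements_def)

lemma elements_dim:
  assumes "A \<in> elements \<A>" "x < length \<A>"
  shows "dim_row (A ! x) = \<A> ! x" "dim_col (A ! x) = \<A> ! x"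
  using assms by (auto simp: elements_def)

text \<open>Reduces equations between elements to scalar equations indexed by \<open>units\<close>,
  the form in which most identities below are proved.\<close>

lemma element_eqI:
  assumes "A \<in> elements \<A>" "B \<in> elements \<A>"
    and "\<And>u. u \<in> units \<A> \<Longrightarrow> coefficient A u = coefficient B u"
  shows "A = B"
proof (rule nth_equalityI)
  show "length A = length B"
    using assms by (simp add: elements_def)
  fix x assume x: "x < length A"
  show "A ! x = B ! x"
  proof (rule eq_matI)
    fix i j assume "i < dim_row (B ! x)" "j < dim_col (B ! x)"
    then have "(x, i, j) \<in> units \<A>"
      using assms x by (auto simp: elements_def units_def)
    then show "A ! x $$ (i, j) = B ! x $$ (i, j)"
      using assms(3) by (force simp: coefficient_def)
  qed (use assms x in \<open>simp_all add: elements_length elements_dim [of _ \<A>]\<close>)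
qed

lemma from_coefficients_elements [simp]: "from_coefficients \<A> f \<in> elements \<A>"
  by (auto simp: from_coefficients_def elements_def)

lemma coefficient_from_coefficients [simp]:
  "u \<in> units \<A> \<Longrightarrow> coefficient (from_coefficients \<A> f) u = f u"
  by (auto simp: from_coefficients_def coefficient_def units_def)

lemma matrix_unit_elements [simp]: "matrix_unit \<A> u \<in> elements \<A>"
  by (simp add: matrix_unit_def)

lemma coefficient_matrix_unit [simp]:
  "v \<in> units \<A> \<Longrightarrow> coefficient (matrix_unit \<A> u) v = (if v = u then 1 else 0)"
  by (simp add: matrix_unit_def)

lemma mm_add_elements [simp]:
  "A \<in> elements \<A> \<Longrightarrow> B \<in> elements \<A> \<Longrightarrow> A \<oplus>\<^sub>M B \<in> elements \<A>"
  by (auto simp: elements_def mm_add_def)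

lemma coefficient_add [simp]:
  "A \<in> elements \<A> \<Longrightarrow> B \<in> elements \<A> \<Longrightarrow> u \<in> units \<A> \<Longrightarrow>
    coefficient (A \<oplus>\<^sub>M B) u = coefficient A u + coefficient B u"
  by (auto simp: elements_def mm_add_def coefficient_def units_def)

lemma mm_scale_elements [simp]: "A \<in> elements \<A> \<Longrightarrow> c \<odot>\<^sub>M A \<in> elements \<A>"
  by (auto simp: elements_def mm_scale_def)

lemma coefficient_scale [simp]:
  "A \<in> elements \<A> \<Longrightarrow> u \<in> units \<A> \<Longrightarrow> coefficient (c \<odot>\<^sub>M A) u = c * coefficient A u"
  by (auto simp: elements_def mm_scale_def coefficient_def units_def)

lemma mm_zero_elements [simp]: "mm_zero \<A> \<in> elements \<A>"
  by (auto simp: elements_def mm_zero_def)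

lemma coefficient_zero [simp]: "u \<in> units \<A> \<Longrightarrow> coefficient (mm_zero \<A>) u = 0"
  by (auto simp: mm_zero_def coefficient_def units_def)

lemma mm_one_elements [simp]: "mm_one \<A> \<in> elements \<A>"
  by (auto simp: elements_def mm_one_def)

lemma coefficient_one [simp]:
  "(x, i, j) \<in> units \<A> \<Longrightarrow> coefficient (mm_one \<A>) (x, i, j) = (if i = j then 1 else 0)"
  by (auto simp: mm_one_def coefficient_def units_def)

text \<open>In particular these coefficients are real, so that conjugation leaves them fixed in
  \<open>hs_inner_one\<close>.\<close>

lemma coefficient_one_cases: "u \<in> units \<A> \<Longrightarrow> coefficient (mm_one \<A>) u \<in> {0, 1}"
  by (cases u) simp

lemma mm_mult_elements [simp]:
  "A \<in> elements \<A> \<Longrightarrow> B \<in> elements \<A> \<Longrightarrow> A \<bullet>\<^sub>M B \<in> elements \<A>"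
  by (auto simp: elements_def mm_mult_def)

lemma coefficient_mult:
  "A \<in> elements \<A> \<Longrightarrow> B \<in> elements \<A> \<Longrightarrow> (x, i, j) \<in> units \<A> \<Longrightarrow>
    coefficient (A \<bullet>\<^sub>M B) (x, i, j) =
      (\<Sum>k<\<A> ! x. coefficient A (x, i, k) * coefficient B (x, k, j))"
  by (force simp: elements_def mm_mult_def coefficient_def units_def scalar_prod_def
      atLeast0LessThan intro!: sum.cong)

lemma mm_dagger_elements [simp]: "A \<in> elements \<A> \<Longrightarrow> mm_dagger A \<in> elements \<A>"
  by (force simp: elements_def mm_dagger_def mat_adjoint_def intro!: carrier_matI)

lemma coefficient_dagger [simp]:
  "A \<in> elements \<A> \<Longrightarrow> u \<in> units \<A> \<Longrightarrow>
    coefficient (mm_dagger A) u = cnj (coefficient A (swap_unit u))"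
  by (force simp: elements_def mm_dagger_def coefficient_def units_def mat_adjoint_def
      mat_of_rows_def)

section \<open>Trace and Hilbert-Schmidt inner product in coefficients\<close>

lemma mm_trace_diagonal:
  assumes "A \<in> elements \<A>"
  shows "mm_trace A = (\<Sum>x<length \<A>. \<Sum>i<\<A> ! x. coefficient A (x, i, i))"
proof -
  have "mm_trace A = (\<Sum>x<length \<A>. \<Sum>i<dim_row (A ! x). A ! x $$ (i, i))"
    using assms by (simp add: mm_trace_def sum_list_sum_nth elements_def atLeast0LessThan)
  also have "\<dots> = (\<Sum>x<length \<A>. \<Sum>i<\<A> ! x. coefficient A (x, i, i))"
    using assms by (force intro!: sum.cong simp: elements_def coefficient_def)
  finally show ?thesis .
qed

text \<open>The coefficients of the unit are the indicator of the diagonal. Writing the trace as a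
  sum over all of \<open>units\<close> allows it to be exchanged with other sums over
  labels.\<close>

lemma mm_trace_coefficients:
  assumes "A \<in> elements \<A>"
  shows "mm_trace A = (\<Sum>u\<in>units \<A>. coefficient A u * coefficient (mm_one \<A>) u)"
proof -
  have "coefficient A (x, i, i) =
      (\<Sum>j<\<A> ! x. coefficient A (x, i, j) * coefficient (mm_one \<A>) (x, i, j))"
    if "x < length \<A>" "i < \<A> ! x" for x i
  proof -
    have "(\<Sum>j<\<A> ! x. coefficient A (x, i, j) * coefficient (mm_one \<A>) (x, i, j)) =
        (\<Sum>j<\<A> ! x. if i = j then coefficient A (x, i, j) else 0)"
      using that by (intro sum.cong) (auto simp: units_def)
    then show ?thesis
      using that by simp
  qed
  then show ?thesis
    by (simp add: mm_trace_diagonal [OF assms] sum_units)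
qed

lemma mm_trace_mult:
  assumes "A \<in> elements \<A>" "B \<in> elements \<A>"
  shows "mm_trace (A \<bullet>\<^sub>M B) = (\<Sum>u\<in>units \<A>. coefficient A u * coefficient B (swap_unit u))"
  using assms
  by (simp add: mm_trace_diagonal [of _ \<A>] sum_units coefficient_mult [of _ \<A>] mem_units)

text \<open>The adjoint contributes one swap of labels and the trace of a product another, one on
  each factor; reindexing by \<open>swap_unit\<close> removes both. Thus the matrix units are
  orthonormal.\<close>

lemma hs_inner_coefficients:
  assumes "A \<in> elements \<A>" "B \<in> elements \<A>"
  shows "hs_inner A B = (\<Sum>u\<in>units \<A>. cnj (coefficient A u) * coefficient B u)"
proof -
  have "hs_inner A B = (\<Sum>u\<in>units \<A>. cnj (coefficient A (swap_unit u)) * coefficient B (swap_unit u))"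
    using assms by (simp add: hs_inner_def mm_trace_mult [of _ \<A>])
  then show ?thesis
    using sum_units_swap [of "\<lambda>u. cnj (coefficient A u) * coefficient B u" \<A>] by simp
qed

lemma hs_inner_matrix_unit:
  assumes "B \<in> elements \<A>" "u \<in> units \<A>"
  shows "hs_inner (matrix_unit \<A> u) B = coefficient B u"
  using assms by (simp add: hs_inner_coefficients [of _ \<A>] if_distrib if_distribR cong: if_cong)

lemma hs_inner_one:
  assumes "A \<in> elements \<A>"
  shows "hs_inner A (mm_one \<A>) = cnj (mm_trace A)" "hs_inner (mm_one \<A>) A = mm_trace A"
proof -
  have "cnj (coefficient (mm_one \<A>) u) = coefficient (mm_one \<A>) u" if "u \<in> units \<A>" for u
    using coefficient_one_cases [OF that] by auto
  then show "hs_inner A (mm_one \<A>) = cnj (mm_trace A)" "hs_inner (mm_one \<A>) A = mm_trace A"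
    using assms by (simp_all add: hs_inner_coefficients [of _ \<A>] mm_trace_coefficients mult.commute)
qed

section \<open>The unit law, commutators and Hermiticity of states\<close>

lemma mm_mult_one_right:
  assumes "A \<in> elements \<A>"
  shows "A \<bullet>\<^sub>M mm_one \<A> = A"
proof (rule element_eqI [of _ \<A>])
  fix u assume u: "u \<in> units \<A>"
  obtain x i j where "u = (x, i, j)" by (cases u)
  moreover have "(\<Sum>k<\<A> ! x. coefficient A (x, i, k) * coefficient (mm_one \<A>) (x, k, j)) =
      (\<Sum>k<\<A> ! x. if k = j then coefficient A (x, i, k) else 0)"
    using u \<open>u = _\<close> by (intro sum.cong) (auto simp: units_def)
  ultimately show "coefficient (A \<bullet>\<^sub>M mm_one \<A>) u = coefficient A u"
    using u assms by (simp add: coefficient_mult [of _ \<A>]) (simp add: mem_units)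
qed (use assms in auto)

lemma mm_mult_one_left:
  assumes "A \<in> elements \<A>"
  shows "mm_one \<A> \<bullet>\<^sub>M A = A"
proof (rule element_eqI [of _ \<A>])
  fix u assume u: "u \<in> units \<A>"
  obtain x i j where "u = (x, i, j)" by (cases u)
  moreover have "(\<Sum>k<\<A> ! x. coefficient (mm_one \<A>) (x, i, k) * coefficient A (x, k, j)) =
      (\<Sum>k<\<A> ! x. if k = i then coefficient A (x, k, j) else 0)"
    using u \<open>u = _\<close> by (intro sum.cong) (auto simp: units_def)
  ultimately show "coefficient (mm_one \<A> \<bullet>\<^sub>M A) u = coefficient A u"
    using u assms by (simp add: coefficient_mult [of _ \<A>]) (simp add: mem_units)
qed (use assms in auto)

lemma mm_commutator_eq_zero_iff:
  assumes "A \<in> elements \<A>" "B \<in> elements \<A>"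
  shows "mm_commutator A B = mm_zero \<A> \<longleftrightarrow> A \<bullet>\<^sub>M B = B \<bullet>\<^sub>M A"
proof -
  have el: "mm_commutator A B \<in> elements \<A>"
    using assms by (force simp: elements_def mm_mult_def mm_commutator_def intro!: minus_carrier_mat)
  have co: "coefficient (mm_commutator A B) u =
      coefficient (A \<bullet>\<^sub>M B) u - coefficient (B \<bullet>\<^sub>M A) u" if "u \<in> units \<A>" for u
    using that assms
    by (cases u) (simp add: mem_units mm_commutator_def mm_mult_def coefficient_def
        elements_length elements_dim [of _ \<A>])
  show ?thesis
  proof
    assume "mm_commutator A B = mm_zero \<A>"
    then show "A \<bullet>\<^sub>M B = B \<bullet>\<^sub>M A"
      using assms co by (intro element_eqI [of _ \<A>]) force+
  next
    assume "A \<bullet>\<^sub>M B = B \<bullet>\<^sub>M A"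
    then show "mm_commutator A B = mm_zero \<A>"
      using el co by (intro element_eqI [of _ \<A>]) force+
  qed
qed

lemma states_elements [simp]: "\<rho> \<in> states \<A> \<Longrightarrow> \<rho> \<in> elements \<A>"
  by (simp add: states_def)

text \<open>Positivity provides a factorization through some \<open>C\<close>, in which the entries
  at \<open>(i, j)\<close> and \<open>(j, i)\<close> are visibly conjugate. This later trades the
  conjugate in \<open>hs_inner \<rho>\<close> for a swap of labels.\<close>

lemma states_hermitian:
  assumes "\<rho> \<in> states \<A>" "u \<in> units \<A>"
  shows "cnj (coefficient \<rho> u) = coefficient \<rho> (swap_unit u)"
proof -
  obtain C where C: "C \<in> elements \<A>" and \<rho>: "\<rho> = mm_dagger C \<bullet>\<^sub>M C"
    using assms unfolding states_def mm_positive_def by blast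
  obtain x i j where u: "u = (x, i, j)" by (cases u)
  then have "coefficient \<rho> (x, i, j) =
      (\<Sum>k<\<A> ! x. cnj (coefficient C (x, k, i)) * coefficient C (x, k, j))"
    and "coefficient \<rho> (x, j, i) =
      (\<Sum>k<\<A> ! x. cnj (coefficient C (x, k, j)) * coefficient C (x, k, i))"
    using C assms(2) by (simp_all add: \<rho> coefficient_mult [of _ \<A>] mem_units)
  then show ?thesis
    by (simp add: u mult.commute)
qed

section \<open>Linear maps\<close>

lemma linear_maps_elements [simp]:
  "\<Phi> \<in> linear_maps \<A> \<B> \<Longrightarrow> A \<in> elements \<A> \<Longrightarrow> \<Phi> A \<in> elements \<B>"
  by (auto simp: linear_maps_def)

text \<open>A linear map is determined by its values on matrix units. The expansion of
  \<open>A\<close> is built up one label at a time, which uses only additivity and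
  homogeneity.\<close>

lemma coefficient_linear_map:
  assumes \<Phi>: "\<Phi> \<in> linear_maps \<A> \<B>" and A: "A \<in> elements \<A>" and v: "v \<in> units \<B>"
  shows "coefficient (\<Phi> A) v =
    (\<Sum>u\<in>units \<A>. coefficient A u * coefficient (\<Phi> (matrix_unit \<A> u)) v)"
proof -
  \<comment> \<open>\<open>?r F\<close> is the truncation of \<open>A\<close> to the labels in
    \<open>F\<close>.\<close>
  let ?r = "\<lambda>F. from_coefficients \<A> (\<lambda>u. if u \<in> F then coefficient A u else 0)"
  have add: "\<Phi> (X \<oplus>\<^sub>M Y) = \<Phi> X \<oplus>\<^sub>M \<Phi> Y"
    if "X \<in> elements \<A>" "Y \<in> elements \<A>" for X Y
    using \<Phi> that by (auto simp: linear_maps_def)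
  have scale: "\<Phi> (c \<odot>\<^sub>M X) = c \<odot>\<^sub>M \<Phi> X" if "X \<in> elements \<A>" for X c
    using \<Phi> that by (auto simp: linear_maps_def)
  have partial: "coefficient (\<Phi> (?r F)) v =
      (\<Sum>u\<in>F. coefficient A u * coefficient (\<Phi> (matrix_unit \<A> u)) v)"
    if "finite F" "F \<subseteq> units \<A>" for F
    using that
  proof (induction F rule: finite_induct)
    case empty
    \<comment> \<open>The scalar 0 is written out so that homogeneity shows that \<Phi> vanishes
      here.\<close>
    have "?r {} = 0 \<odot>\<^sub>M mm_zero \<A>"
      by (rule element_eqI [of _ \<A>]) (simp_all add: coefficient_scale [of _ \<A>])
    then show ?case
      using \<Phi> v by (simp add: scale coefficient_scale [of _ \<B>])
  next
    case (insert u F)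
    have "?r (insert u F) = coefficient A u \<odot>\<^sub>M matrix_unit \<A> u \<oplus>\<^sub>M ?r F"
      using insert
      by (intro element_eqI [of _ \<A>])
        (auto simp: coefficient_scale [of _ \<A>] coefficient_add [of _ \<A>])
    then show ?case
      using insert \<Phi> v
      by (simp add: scale add coefficient_scale [of _ \<B>] coefficient_add [of _ \<B>])
  qed
  have full: "?r (units \<A>) = A"
    using A by (intro element_eqI [of _ \<A>]) auto
  from partial [OF finite_units order_refl] show ?thesis
    unfolding full .
qed

text \<open>Testing the defining relation on matrix units forces these coefficients, and linearity
  extends the relation from matrix units to all elements. Existence and uniqueness together evaluate
  the definite description.\<close>

lemma hs_adjoint_elements:
  assumes \<Phi>: "\<Phi> \<in> linear_maps \<A> \<B>" and B: "B \<in> elements \<B>"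
  shows "hs_adjoint \<A> \<B> \<Phi> B =
    from_coefficients \<A> (\<lambda>u. hs_inner (\<Phi> (matrix_unit \<A> u)) B)" (is "_ = ?C")
proof -
  have "hs_inner (\<Phi> A) B = hs_inner A ?C" if "A \<in> elements \<A>" for A
  proof -
    have "hs_inner (\<Phi> A) B = (\<Sum>v\<in>units \<B>. \<Sum>u\<in>units \<A>.
        cnj (coefficient A u) * cnj (coefficient (\<Phi> (matrix_unit \<A> u)) v) * coefficient B v)"
      using that \<Phi> B
      by (simp add: hs_inner_coefficients [of _ \<B>] coefficient_linear_map [OF \<Phi> that] sum_distrib_right)
    also have "\<dots> = (\<Sum>u\<in>units \<A>. \<Sum>v\<in>units \<B>.
        cnj (coefficient A u) * cnj (coefficient (\<Phi> (matrix_unit \<A> u)) v) * coefficient B v)"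
      by (rule sum.swap)
    also have "\<dots> = hs_inner A ?C"
      using that \<Phi> B
      by (simp add: hs_inner_coefficients [of _ \<A>] hs_inner_coefficients [of _ \<B>]
          sum_distrib_left mult.assoc)
    finally show ?thesis .
  qed
  moreover have "C = ?C"
    if "C \<in> elements \<A>" "\<forall>A\<in>elements \<A>. hs_inner (\<Phi> A) B = hs_inner A C" for C
  proof (rule element_eqI [of _ \<A>])
    fix u assume u: "u \<in> units \<A>"
    have "hs_inner (\<Phi> (matrix_unit \<A> u)) B = hs_inner (matrix_unit \<A> u) C"
      using that(2) by (rule bspec) (rule matrix_unit_elements)
    with u that(1) show "coefficient C u = coefficient ?C u"
      by (simp add: hs_inner_matrix_unit)
  qed (use that in simp_all)
  ultimately have "(THE C. C \<in> elements \<A> \<and> (\<forall>A\<in>elements \<A>. hs_inner (\<Phi> A) B = hs_inner A C)) = ?C"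
    by (intro the_equality conjI ballI from_coefficients_elements) blast+
  then show ?thesis
    using B by (simp add: hs_adjoint_def)
qed

section \<open>Tensor products\<close>

lemma length_tensor_algebra [simp]: "length (\<A> \<otimes>\<^sub>A \<B>) = length \<A> * length \<B>"
  by (simp add: tensor_algebra_def)

text \<open>Keeps lexicographic encodings in range, both for block positions and for row and column
  indices.\<close>

lemma mult_add_less: "x < m \<Longrightarrow> y < n \<Longrightarrow> x * n + y < m * (n :: nat)"
proof -
  assume "x < m" "y < n"
  then have "x * n + y < Suc x * n" and "Suc x * n \<le> m * n"
    by (auto intro: mult_le_mono1 simp del: mult_Suc) simp
  then show "x * n + y < m * n" by linarith
qed

lemma mult_add_div: "y < n \<Longrightarrow> (x * n + y) div n = (x :: nat)"
  by simp

lemma nth_tensor_algebra: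
  "x < length \<A> \<Longrightarrow> y < length \<B> \<Longrightarrow> (\<A> \<otimes>\<^sub>A \<B>) ! (x * length \<B> + y) = \<A> ! x * \<B> ! y"
  by (simp add: tensor_algebra_def product_nth mult_add_less mult_add_div)

text \<open>Division with remainder inverts the encoding. It lets sums and equalities over labels of
  the tensor product be handled by pairs of labels.\<close>

lemma bij_betw_pair_unit:
  "bij_betw (\<lambda>(u, v). pair_unit \<A> \<B> u v) (units \<A> \<times> units \<B>) (units (\<A> \<otimes>\<^sub>A \<B>))"
proof (rule bij_betw_byWitness)
  let ?f = "\<lambda>(u, v). pair_unit \<A> \<B> u v"
  \<comment> \<open>The block position is decoded first, since the divisor \<open>n\<close> for rows
    and columns is the size of the right-hand block found there.\<close>
  let ?g = "\<lambda>(z, p, q). let y = z mod length \<B>; n = \<B> ! y in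
    ((z div length \<B>, p div n, q div n), (y, p mod n, q mod n))"
  show "\<forall>w\<in>units \<A> \<times> units \<B>. ?g (?f w) = w"
    by (auto simp: pair_unit_def mem_units Let_def mult_add_div)
  show "\<forall>w\<in>units (\<A> \<otimes>\<^sub>A \<B>). ?f (?g w) = w"
    by (auto simp: pair_unit_def Let_def div_mult_mod_eq)
  show "?f ` (units \<A> \<times> units \<B>) \<subseteq> units (\<A> \<otimes>\<^sub>A \<B>)"
    by (auto simp: pair_unit_def mem_units nth_tensor_algebra mult_add_less)
  show "?g ` units (\<A> \<otimes>\<^sub>A \<B>) \<subseteq> units \<A> \<times> units \<B>"
  proof
    fix w assume "w \<in> ?g ` units (\<A> \<otimes>\<^sub>A \<B>)"
    then obtain z p q where z: "z < length \<A> * length \<B>"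
      and pq: "p < (\<A> \<otimes>\<^sub>A \<B>) ! z" "q < (\<A> \<otimes>\<^sub>A \<B>) ! z" and w: "w = ?g (z, p, q)"
      by (auto simp: mem_units)
    define x y where "x = z div length \<B>" and "y = z mod length \<B>"
    have xy: "x < length \<A>" "y < length \<B>"
      using z by (auto simp: x_def y_def less_mult_imp_div_less intro: mod_less_divisor gr0I)
    moreover have "z = x * length \<B> + y"
      by (simp add: x_def y_def)
    ultimately have "p < \<A> ! x * \<B> ! y" "q < \<A> ! x * \<B> ! y"
      using pq nth_tensor_algebra by auto
    \<comment> \<open>An index below the product excludes an empty right-hand block, so remainders
      modulo its size are in range.\<close>
    moreover from this have "0 < \<B> ! y"
      by (auto intro: gr0I)
    ultimately show "w \<in> units \<A> \<times> units \<B>"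
      using xy by (simp add: w mem_units Let_def less_mult_imp_div_less flip: x_def y_def)
  qed
qed

lemma pair_unit_units:
  "u \<in> units \<A> \<Longrightarrow> v \<in> units \<B> \<Longrightarrow> pair_unit \<A> \<B> u v \<in> units (\<A> \<otimes>\<^sub>A \<B>)"
  using bij_betw_apply [OF bij_betw_pair_unit] by fastforce

lemma pair_unit_eq_iff:
  assumes "u \<in> units \<A>" "v \<in> units \<B>" "u' \<in> units \<A>" "v' \<in> units \<B>"
  shows "pair_unit \<A> \<B> u v = pair_unit \<A> \<B> u' v' \<longleftrightarrow> u = u' \<and> v = v'"
  using inj_onD [OF bij_betw_imp_inj_on [OF bij_betw_pair_unit [of \<A> \<B>]], of "(u, v)" "(u', v')"] assms
  by auto

lemma units_tensor_cases:
  assumes "w \<in> units (\<A> \<otimes>\<^sub>A \<B>)"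
  obtains u v where "u \<in> units \<A>" "v \<in> units \<B>" "w = pair_unit \<A> \<B> u v"
  using assms bij_betw_imp_surj_on [OF bij_betw_pair_unit [of \<A> \<B>]] by force

lemma tensor_element_eqI:
  assumes "Z \<in> elements (\<A> \<otimes>\<^sub>A \<B>)" "W \<in> elements (\<A> \<otimes>\<^sub>A \<B>)"
    and "\<And>u v. u \<in> units \<A> \<Longrightarrow> v \<in> units \<B> \<Longrightarrow>
      coefficient Z (pair_unit \<A> \<B> u v) = coefficient W (pair_unit \<A> \<B> u v)"
  shows "Z = W"
  using assms by (metis element_eqI units_tensor_cases)

section \<open>Elementary tensors and products in the tensor algebra\<close>

lemma tensor_elements [simp]:
  assumes "A \<in> elements \<A>" "B \<in> elements \<B>"
  shows "A \<otimes>\<^sub>M B \<in> elements (\<A> \<otimes>\<^sub>A \<B>)"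
proof -
  have "(A \<otimes>\<^sub>M B) ! z \<in> carrier_mat ((\<A> \<otimes>\<^sub>A \<B>) ! z) ((\<A> \<otimes>\<^sub>A \<B>) ! z)"
    if z: "z < length \<A> * length \<B>" for z
  proof -
    have "z div length \<B> < length \<A>" "z mod length \<B> < length \<B>"
      using z by (auto simp: less_mult_imp_div_less intro: mod_less_divisor gr0I)
    then show ?thesis
      using z assms
      by (auto simp: tensor_def tensor_algebra_def product_nth elements_length elements_dim kronecker_def)
  qed
  then show ?thesis
    using assms by (simp add: elements_def tensor_def)
qed

lemma coefficient_tensor:
  assumes "A \<in> elements \<A>" "B \<in> elements \<B>" "u \<in> units \<A>" "v \<in> units \<B>"
  shows "coefficient (A \<otimes>\<^sub>M B) (pair_unit \<A> \<B> u v) = coefficient A u * coefficient B v"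
proof -
  obtain x i j y k l where "u = (x, i, j)" "v = (y, k, l)"
    by (metis prod_cases3)
  then show ?thesis
    using assms
    by (simp add: pair_unit_def coefficient_def tensor_def mem_units product_nth elements_length
        elements_dim [of _ \<A>] elements_dim [of _ \<B>] kronecker_def mult_add_less mult_add_div)
qed

text \<open>Cuts the range into \<open>m\<close> consecutive stretches of length \<open>n\<close>.
  This splits the inner index of a matrix product in the tensor algebra into a left and a right
  index.\<close>

lemma sum_mult_less:
  "(\<Sum>r<m * n. f r) = (\<Sum>p<m. \<Sum>q<n. f (p * n + q))" for m n :: nat
proof -
  have "(\<Sum>r\<in>{p * n..<p * n + n}. f r) = (\<Sum>q<n. f (p * n + q))" for p
    using sum.shift_bounds_nat_ivl [of f 0 "p * n" n]
    by (simp add: atLeast0LessThan add.commute)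
  then show ?thesis
    by (simp flip: sum.nat_group)
qed

lemma coefficient_mult_tensor_algebra:
  assumes "Z \<in> elements (\<A> \<otimes>\<^sub>A \<B>)" "W \<in> elements (\<A> \<otimes>\<^sub>A \<B>)"
    and "(x, i, j) \<in> units \<A>" "(y, k, l) \<in> units \<B>"
  shows "coefficient (Z \<bullet>\<^sub>M W) (pair_unit \<A> \<B> (x, i, j) (y, k, l)) =
    (\<Sum>p<\<A> ! x. \<Sum>q<\<B> ! y. coefficient Z (pair_unit \<A> \<B> (x, i, p) (y, k, q)) *
      coefficient W (pair_unit \<A> \<B> (x, p, j) (y, q, l)))"
  using assms pair_unit_units [OF assms(3,4)]
  by (simp add: pair_unit_def coefficient_mult [of _ "\<A> \<otimes>\<^sub>A \<B>"] mem_units nth_tensor_algebra sum_mult_less)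

section \<open>Lifts of bilinear maps and partial traces\<close>

lemma tensor_lift_elements [simp]:
  "Z \<in> elements (\<A> \<otimes>\<^sub>A \<B>) \<Longrightarrow> tensor_lift \<A> \<B> \<C> \<beta> Z \<in> elements \<C>"
  by (simp add: tensor_lift_def)

lemma coefficient_tensor_lift:
  "Z \<in> elements (\<A> \<otimes>\<^sub>A \<B>) \<Longrightarrow> w \<in> units \<C> \<Longrightarrow>
    coefficient (tensor_lift \<A> \<B> \<C> \<beta> Z) w =
      (\<Sum>u\<in>units \<A>. \<Sum>v\<in>units \<B>. coefficient Z (pair_unit \<A> \<B> u v) *
        coefficient (\<beta> (matrix_unit \<A> u) (matrix_unit \<B> v)) w)"
  by (simp add: tensor_lift_def)

text \<open>Linear by construction: \<beta> enters only through its values on pairs of matrix units,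
  as fixed vectors weighted by the coefficients of the argument.\<close>

lemma tensor_lift_linear: "tensor_lift \<A> \<B> \<C> \<beta> \<in> linear_maps (\<A> \<otimes>\<^sub>A \<B>) \<C>"
proof -
  have "tensor_lift \<A> \<B> \<C> \<beta> \<in> elements (\<A> \<otimes>\<^sub>A \<B>) \<rightarrow>\<^sub>E elements \<C>"
    by (auto simp: tensor_lift_def)
  moreover have "tensor_lift \<A> \<B> \<C> \<beta> (Z \<oplus>\<^sub>M W) =
      tensor_lift \<A> \<B> \<C> \<beta> Z \<oplus>\<^sub>M tensor_lift \<A> \<B> \<C> \<beta> W"
    if "Z \<in> elements (\<A> \<otimes>\<^sub>A \<B>)" "W \<in> elements (\<A> \<otimes>\<^sub>A \<B>)" for Z W
    using that
    by (intro element_eqI [of _ \<C>])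
      (simp_all add: coefficient_tensor_lift coefficient_add [of _ \<C>]
        coefficient_add [of _ "\<A> \<otimes>\<^sub>A \<B>"] pair_unit_units ring_distribs sum.distrib)
  moreover have "tensor_lift \<A> \<B> \<C> \<beta> (c \<odot>\<^sub>M Z) = c \<odot>\<^sub>M tensor_lift \<A> \<B> \<C> \<beta> Z"
    if "Z \<in> elements (\<A> \<otimes>\<^sub>A \<B>)" for c Z
    using that
    by (intro element_eqI [of _ \<C>])
      (simp_all add: coefficient_tensor_lift coefficient_scale [of _ \<C>]
        coefficient_scale [of _ "\<A> \<otimes>\<^sub>A \<B>"] pair_unit_units sum_distrib_left mult.assoc)
  ultimately show ?thesis
    by (auto simp: linear_maps_def)
qed

text \<open>The matrix unit with a paired label is the tensor of two matrix units; injectivity of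
  the pairing leaves one term of the double sum.\<close>

lemma tensor_lift_matrix_unit:
  assumes "u \<in> units \<A>" "v \<in> units \<B>" "\<beta> (matrix_unit \<A> u) (matrix_unit \<B> v) \<in> elements \<C>"
  shows "tensor_lift \<A> \<B> \<C> \<beta> (matrix_unit (\<A> \<otimes>\<^sub>A \<B>) (pair_unit \<A> \<B> u v)) =
    \<beta> (matrix_unit \<A> u) (matrix_unit \<B> v)"
proof (rule element_eqI [of _ \<C>])
  fix w assume w: "w \<in> units \<C>"
  let ?c = "\<lambda>u' v'. coefficient (\<beta> (matrix_unit \<A> u') (matrix_unit \<B> v')) w"
  have "coefficient (tensor_lift \<A> \<B> \<C> \<beta> (matrix_unit (\<A> \<otimes>\<^sub>A \<B>) (pair_unit \<A> \<B> u v))) w =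
      (\<Sum>u'\<in>units \<A>. \<Sum>v'\<in>units \<B>. if u' = u then if v' = v then ?c u' v' else 0 else 0)"
    using assms w
    by (auto simp: coefficient_tensor_lift pair_unit_units pair_unit_eq_iff intro!: sum.cong)
  also have "\<dots> = (\<Sum>u'\<in>units \<A>. if u' = u then ?c u' v else 0)"
    using assms(2) by (intro sum.cong) auto
  also have "\<dots> = ?c u v"
    using assms(1) by simp
  finally show "coefficient (tensor_lift \<A> \<B> \<C> \<beta>
      (matrix_unit (\<A> \<otimes>\<^sub>A \<B>) (pair_unit \<A> \<B> u v))) w = ?c u v" .
qed (use assms in simp_all)

lemma mm_trace_matrix_unit:
  "u \<in> units \<A> \<Longrightarrow> mm_trace (matrix_unit \<A> u) = coefficient (mm_one \<A>) u"
  by (simp add: mm_trace_coefficients [of _ \<A>] if_one_zero_mult)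

text \<open>Only the left label \<open>u\<close> survives, and each right matrix unit is replaced by
  its trace, a coefficient of the unit.\<close>

lemma coefficient_partial_trace_right:
  assumes "Z \<in> elements (\<A> \<otimes>\<^sub>A \<B>)" "u \<in> units \<A>"
  shows "coefficient (partial_trace_right \<A> \<B> Z) u =
    (\<Sum>v\<in>units \<B>. coefficient Z (pair_unit \<A> \<B> u v) * coefficient (mm_one \<B>) v)"
proof -
  have "coefficient (partial_trace_right \<A> \<B> Z) u = (\<Sum>u'\<in>units \<A>. if u = u' then
      \<Sum>v\<in>units \<B>. coefficient Z (pair_unit \<A> \<B> u' v) * coefficient (mm_one \<B>) v else 0)"
    unfolding partial_trace_right_def coefficient_tensor_lift [OF assms]
    using assms(2)
    by (intro sum.cong refl) (auto simp: coefficient_scale [of _ \<A>] mm_trace_matrix_unit)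
  then show ?thesis
    using assms(2) by simp
qed

lemma coefficient_partial_trace_left:
  assumes "Z \<in> elements (\<A> \<otimes>\<^sub>A \<B>)" "v \<in> units \<B>"
  shows "coefficient (partial_trace_left \<A> \<B> Z) v =
    (\<Sum>u\<in>units \<A>. coefficient Z (pair_unit \<A> \<B> u v) * coefficient (mm_one \<A>) u)"
proof -
  have "(\<Sum>v'\<in>units \<B>. coefficient Z (pair_unit \<A> \<B> u v') *
      coefficient (mm_trace (matrix_unit \<A> u) \<odot>\<^sub>M matrix_unit \<B> v') v) =
      (\<Sum>v'\<in>units \<B>. if v = v' then
        coefficient Z (pair_unit \<A> \<B> u v') * coefficient (mm_one \<A>) u else 0)"
    if "u \<in> units \<A>" for u
    using assms that
    by (intro sum.cong refl)
      (auto simp: coefficient_scale [of _ \<B>] mm_trace_matrix_unit)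
  then show ?thesis
    using assms by (simp add: partial_trace_left_def coefficient_tensor_lift)
qed

section \<open>Channel states and their slices\<close>

text \<open>Up to conjugation this coefficient is the trace of \<open>e_u e_v\<close>, which is 1 if
  \<open>e_v\<close> is the adjoint of \<open>e_u\<close> and 0 otherwise. Hence the adjoint of
  multiplication sends the unit to the sum of all \<open>e_u\<close> tensored with their
  adjoints.\<close>

lemma coefficient_adjoint_mult_map_one:
  assumes "u \<in> units \<A>" "v \<in> units \<A>"
  shows "coefficient (hs_adjoint (\<A> \<otimes>\<^sub>A \<A>) \<A> (mult_map \<A>) (mm_one \<A>)) (pair_unit \<A> \<A> u v) =
    (if v = swap_unit u then 1 else 0)"
proof -
  have "mm_trace (matrix_unit \<A> u \<bullet>\<^sub>M matrix_unit \<A> v) =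
      (\<Sum>w\<in>units \<A>. if w = u then if swap_unit w = v then 1 else 0 else 0)"
    unfolding mm_trace_mult [OF matrix_unit_elements matrix_unit_elements]
    by (intro sum.cong refl) auto
  then have "mm_trace (matrix_unit \<A> u \<bullet>\<^sub>M matrix_unit \<A> v) = (if v = swap_unit u then 1 else 0)"
    using assms by auto
  moreover have "mult_map \<A> \<in> linear_maps (\<A> \<otimes>\<^sub>A \<A>) \<A>"
    by (simp add: mult_map_def tensor_lift_linear)
  ultimately show ?thesis
    using assms
    by (simp add: hs_adjoint_elements pair_unit_units mult_map_def tensor_lift_matrix_unit
        hs_inner_one [of _ \<A>])
qed

lemma channel_state_elements [simp]: "channel_state \<A> \<B> \<Phi> \<in> elements (\<A> \<otimes>\<^sub>A \<B>)"
proof -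
  have "mult_map \<A> \<in> linear_maps (\<A> \<otimes>\<^sub>A \<A>) \<A>"
    by (simp add: mult_map_def tensor_lift_linear)
  then show ?thesis
    by (simp add: channel_state_def tensor_map_def hs_adjoint_elements)
qed

lemma coefficient_channel_state:
  assumes "\<And>A. A \<in> elements \<A> \<Longrightarrow> \<Phi> A \<in> elements \<B>" "u \<in> units \<A>" "v \<in> units \<B>"
  shows "coefficient (channel_state \<A> \<B> \<Phi>) (pair_unit \<A> \<B> u v) =
    coefficient (\<Phi> (matrix_unit \<A> (swap_unit u))) v"
proof -
  have "mult_map \<A> \<in> linear_maps (\<A> \<otimes>\<^sub>A \<A>) \<A>"
    by (simp add: mult_map_def tensor_lift_linear)
  then have el: "hs_adjoint (\<A> \<otimes>\<^sub>A \<A>) \<A> (mult_map \<A>) (mm_one \<A>) \<in> elements (\<A> \<otimes>\<^sub>A \<A>)"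
    by (simp add: hs_adjoint_elements)
  let ?c = "\<lambda>u'. coefficient (\<Phi> (matrix_unit \<A> u')) v"
  have "coefficient (channel_state \<A> \<B> \<Phi>) (pair_unit \<A> \<B> u v) =
      (\<Sum>u'\<in>units \<A>. \<Sum>v'\<in>units \<A>. if v' = swap_unit u' then if u = u' then ?c v' else 0 else 0)"
    unfolding channel_state_def tensor_map_def
      coefficient_tensor_lift [OF el pair_unit_units [OF assms(2,3)]]
    using assms
    by (intro sum.cong refl)
      (auto simp: id_map_def coefficient_adjoint_mult_map_one coefficient_tensor)
  also have "\<dots> = (\<Sum>u'\<in>units \<A>. if u = u' then ?c (swap_unit u') else 0)"
    by (intro sum.cong) simp_all
  also have "\<dots> = ?c (swap_unit u)"
    using assms(2) by simp
  finally show ?thesis .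
qed

text \<open>The slices are determined by \<open>Z = \<Sum>\<^sub>v slice \<A> \<B> Z v \<otimes> e\<^sub>v\<close>.\<close>

definition slice :: "algebra \<Rightarrow> algebra \<Rightarrow> element \<Rightarrow> nat \<times> nat \<times> nat \<Rightarrow> element" where
  "slice \<A> \<B> Z v = from_coefficients \<A> (\<lambda>u. coefficient Z (pair_unit \<A> \<B> u v))"

lemma slice_elements [simp]: "slice \<A> \<B> Z v \<in> elements \<A>"
  by (simp add: slice_def)

lemma coefficient_slice [simp]:
  "u \<in> units \<A> \<Longrightarrow> coefficient (slice \<A> \<B> Z v) u = coefficient Z (pair_unit \<A> \<B> u v)"
  by (simp add: slice_def)

text \<open>The identity keeps the right label \<open>v\<close> fixed, and linearity of
  \<open>T\<close> gathers the remaining sum over left labels into the image of one slice.\<close>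

lemma coefficient_tensor_map_id:
  assumes T: "T \<in> linear_maps \<A> \<C>" and Z: "Z \<in> elements (\<A> \<otimes>\<^sub>A \<B>)"
    and u: "u \<in> units \<C>" and v: "v \<in> units \<B>"
  shows "coefficient (tensor_map \<A> \<B> \<C> \<B> T (id_map \<B>) Z) (pair_unit \<C> \<B> u v) =
    coefficient (T (slice \<A> \<B> Z v)) u"
proof -
  have "(\<Sum>v'\<in>units \<B>. coefficient Z (pair_unit \<A> \<B> u' v') *
      coefficient (T (matrix_unit \<A> u') \<otimes>\<^sub>M id_map \<B> (matrix_unit \<B> v')) (pair_unit \<C> \<B> u v)) =
      (\<Sum>v'\<in>units \<B>. if v = v' then
        coefficient Z (pair_unit \<A> \<B> u' v') * coefficient (T (matrix_unit \<A> u')) u else 0)" for u'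
    using T u v
    by (intro sum.cong) (auto simp: id_map_def coefficient_tensor [of _ \<C> _ \<B>])
  then show ?thesis
    using Z u v
    by (simp add: tensor_map_def coefficient_tensor_lift pair_unit_units
        coefficient_linear_map [OF T slice_elements u])
qed

text \<open>The unit on the right factor leaves the label \<open>v\<close> alone, so the product
  acts slice by slice.\<close>

lemma slice_mult_tensor_one_right:
  assumes Z: "Z \<in> elements (\<A> \<otimes>\<^sub>A \<B>)" and A: "A \<in> elements \<A>" and v: "v \<in> units \<B>"
  shows "slice \<A> \<B> (Z \<bullet>\<^sub>M (A \<otimes>\<^sub>M mm_one \<B>)) v = slice \<A> \<B> Z v \<bullet>\<^sub>M A"
proof (rule element_eqI [of _ \<A>])
  fix u assume u: "u \<in> units \<A>"
  obtain x i j where ux: "u = (x, i, j)" by (cases u)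
  obtain y k l where vy: "v = (y, k, l)" by (cases v)
  note uv = u [unfolded ux] v [unfolded vy]
  have "coefficient (Z \<bullet>\<^sub>M (A \<otimes>\<^sub>M mm_one \<B>)) (pair_unit \<A> \<B> u v) =
      (\<Sum>p<\<A> ! x. \<Sum>q<\<B> ! y. if q = l then
        coefficient Z (pair_unit \<A> \<B> (x, i, p) (y, k, q)) * coefficient A (x, p, j) else 0)"
    unfolding ux vy coefficient_mult_tensor_algebra
      [OF Z tensor_elements [OF A mm_one_elements] uv]
    using A uv by (intro sum.cong refl) (auto simp: coefficient_tensor mem_units)
  also have "\<dots> = coefficient (slice \<A> \<B> Z v \<bullet>\<^sub>M A) u"
    using A uv by (simp add: ux coefficient_mult [of _ \<A>] mem_units vy)
  finally show "coefficient (slice \<A> \<B> (Z \<bullet>\<^sub>M (A \<otimes>\<^sub>M mm_one \<B>)) v) u =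
      coefficient (slice \<A> \<B> Z v \<bullet>\<^sub>M A) u"
    using u by simp
qed (use A in simp_all)

lemma slice_mult_tensor_one_left:
  assumes Z: "Z \<in> elements (\<A> \<otimes>\<^sub>A \<B>)" and A: "A \<in> elements \<A>" and v: "v \<in> units \<B>"
  shows "slice \<A> \<B> ((A \<otimes>\<^sub>M mm_one \<B>) \<bullet>\<^sub>M Z) v = A \<bullet>\<^sub>M slice \<A> \<B> Z v"
proof (rule element_eqI [of _ \<A>])
  fix u assume u: "u \<in> units \<A>"
  obtain x i j where ux: "u = (x, i, j)" by (cases u)
  obtain y k l where vy: "v = (y, k, l)" by (cases v)
  note uv = u [unfolded ux] v [unfolded vy]
  have "coefficient ((A \<otimes>\<^sub>M mm_one \<B>) \<bullet>\<^sub>M Z) (pair_unit \<A> \<B> u v) =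
      (\<Sum>p<\<A> ! x. \<Sum>q<\<B> ! y. if q = k then
        coefficient A (x, i, p) * coefficient Z (pair_unit \<A> \<B> (x, p, j) (y, q, l)) else 0)"
    unfolding ux vy coefficient_mult_tensor_algebra
      [OF tensor_elements [OF A mm_one_elements] Z uv]
    using A uv by (intro sum.cong refl) (auto simp: coefficient_tensor mem_units)
  also have "\<dots> = coefficient (A \<bullet>\<^sub>M slice \<A> \<B> Z v) u"
    using A uv by (simp add: ux coefficient_mult [of _ \<A>] mem_units vy)
  finally show "coefficient (slice \<A> \<B> ((A \<otimes>\<^sub>M mm_one \<B>) \<bullet>\<^sub>M Z) v) u =
      coefficient (A \<bullet>\<^sub>M slice \<A> \<B> Z v) u"
    using u by simp
qed (use A in simp_all)

section \<open>The rendered state over time\<close>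

lemma rendered_sot_elements [simp]: "rendered_sot \<Theta> \<A> \<B> \<E> \<rho> \<in> elements (\<A> \<otimes>\<^sub>A \<B>)"
  by (simp add: rendered_sot_def tensor_map_def)

lemma coefficient_rendered_sot:
  assumes "\<Theta> \<A> \<rho> \<in> linear_maps \<A> \<A>" "u \<in> units \<A>" "v \<in> units \<B>"
  shows "coefficient (rendered_sot \<Theta> \<A> \<B> \<E> \<rho>) (pair_unit \<A> \<B> u v) =
    coefficient (\<Theta> \<A> \<rho> (slice \<A> \<B> (channel_state \<A> \<B> \<E>) v)) u"
  using assms by (simp add: rendered_sot_def coefficient_tensor_map_id)

section \<open>The two marginals\<close>

lemma partial_trace_right_rendered_sot:
  assumes T: "\<Theta> \<A> \<rho> \<in> linear_maps \<A> \<A>" and E: "\<E> \<in> TP \<A> \<B>"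
  shows "partial_trace_right \<A> \<B> (rendered_sot \<Theta> \<A> \<B> \<E> \<rho>) = \<Theta> \<A> \<rho> (mm_one \<A>)"
proof (rule element_eqI [of _ \<A>])
  have EL: "\<E> A \<in> elements \<B>" and tr: "mm_trace (\<E> A) = mm_trace A" if "A \<in> elements \<A>" for A
    using E that by (auto simp: TP_def)
  fix u assume u: "u \<in> units \<A>"
  let ?e = "\<lambda>u'. matrix_unit \<A> u'"
  have "coefficient (partial_trace_right \<A> \<B> (rendered_sot \<Theta> \<A> \<B> \<E> \<rho>)) u =
      (\<Sum>v\<in>units \<B>. \<Sum>u'\<in>units \<A>. coefficient (\<E> (?e (swap_unit u'))) v *
        coefficient (\<Theta> \<A> \<rho> (?e u')) u * coefficient (mm_one \<B>) v)"
    using u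
    by (simp add: coefficient_partial_trace_right coefficient_rendered_sot [of \<Theta> \<A> \<rho>, OF T]
        coefficient_linear_map [OF T slice_elements] coefficient_channel_state EL sum_distrib_right)
  \<comment> \<open>With \<open>u'\<close> fixed, the sum over \<open>v\<close> assembles the trace
    of the image of one matrix unit.\<close>
  also have "\<dots> = (\<Sum>u'\<in>units \<A>. \<Sum>v\<in>units \<B>. coefficient (\<E> (?e (swap_unit u'))) v *
        coefficient (\<Theta> \<A> \<rho> (?e u')) u * coefficient (mm_one \<B>) v)"
    by (rule sum.swap)
  also have "\<dots> = (\<Sum>u'\<in>units \<A>. mm_trace (\<E> (?e (swap_unit u'))) * coefficient (\<Theta> \<A> \<rho> (?e u')) u)"
    by (simp add: mm_trace_coefficients [of _ \<B>] EL sum_distrib_left sum_distrib_right mult_ac)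
  \<comment> \<open>Trace preservation removes \<E>; the swap then disappears because the diagonal
    is symmetric.\<close>
  also have "\<dots> = (\<Sum>u'\<in>units \<A>. coefficient (mm_one \<A>) u' * coefficient (\<Theta> \<A> \<rho> (?e u')) u)"
    by (intro sum.cong) (auto simp: tr mm_trace_matrix_unit mem_units split: if_splits)
  also have "\<dots> = coefficient (\<Theta> \<A> \<rho> (mm_one \<A>)) u"
    by (rule coefficient_linear_map [OF T mm_one_elements u, symmetric])
  finally show "coefficient (partial_trace_right \<A> \<B> (rendered_sot \<Theta> \<A> \<B> \<E> \<rho>)) u =
      coefficient (\<Theta> \<A> \<rho> (mm_one \<A>)) u" .
qed (use T in \<open>simp_all add: partial_trace_right_def\<close>)

lemma partial_trace_left_rendered_sot:
  assumes T: "\<Theta> \<A> \<rho> \<in> linear_maps \<A> \<A>" and E: "\<E> \<in> TP \<A> \<B>" and \<rho>: "\<rho> \<in> states \<A>"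
    and sa: "hs_selfadjoint \<A> (\<Theta> \<A> \<rho>)" and one: "\<Theta> \<A> \<rho> (mm_one \<A>) = \<rho>"
  shows "partial_trace_left \<A> \<B> (rendered_sot \<Theta> \<A> \<B> \<E> \<rho>) = \<E> \<rho>"
proof -
  have EL: "\<E> \<in> linear_maps \<A> \<B>"
    using E by (simp add: TP_def)
  show ?thesis
  proof (rule element_eqI [of _ \<B>])
    fix v assume v: "v \<in> units \<B>"
    let ?A = "slice \<A> \<B> (channel_state \<A> \<B> \<E>) v"
    have TA: "\<Theta> \<A> \<rho> ?A \<in> elements \<A>"
      using T by simp
    have "coefficient (partial_trace_left \<A> \<B> (rendered_sot \<Theta> \<A> \<B> \<E> \<rho>)) v = mm_trace (\<Theta> \<A> \<rho> ?A)"
      using v TA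
      by (simp add: coefficient_partial_trace_left coefficient_rendered_sot [of \<Theta> \<A> \<rho>, OF T]
          mm_trace_coefficients [of _ \<A>])
    also have "\<dots> = hs_inner (mm_one \<A>) (\<Theta> \<A> \<rho> ?A)"
      using TA by (simp add: hs_inner_one [of _ \<A>])
    \<comment> \<open>Self-adjointness moves the rendering map onto the unit, where its value is
      \<rho>.\<close>
    also have "\<dots> = hs_inner \<rho> ?A"
      using sa one slice_elements mm_one_elements unfolding hs_selfadjoint_def by metis
    \<comment> \<open>Hermiticity of \<rho> produces the same swap that the channel state carries,
      so one reindexing undoes both.\<close>
    also have "\<dots> = (\<Sum>u\<in>units \<A>. coefficient \<rho> (swap_unit u) *
        coefficient (\<E> (matrix_unit \<A> (swap_unit u))) v)"
      using \<rho> v EL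
      by (simp add: hs_inner_coefficients [of _ \<A>] states_hermitian coefficient_channel_state)
    also have "\<dots> = (\<Sum>u\<in>units \<A>. coefficient \<rho> u * coefficient (\<E> (matrix_unit \<A> u)) v)"
      by (rule sum_units_swap)
    also have "\<dots> = coefficient (\<E> \<rho>) v"
      by (rule coefficient_linear_map [OF EL states_elements [OF \<rho>] v, symmetric])
    finally show "coefficient (partial_trace_left \<A> \<B> (rendered_sot \<Theta> \<A> \<B> \<E> \<rho>)) v =
        coefficient (\<E> \<rho>) v" .
  qed (use linear_maps_elements [OF EL states_elements [OF \<rho>]] in
      \<open>simp_all add: partial_trace_left_def\<close>)
qed

text \<open>The process enters only through its values on matrix units, and each of those occurs
  linearly.\<close>

lemma rendered_sot_affine_comb:
  assumes T: "\<Theta> \<A> \<rho> \<in> linear_maps \<A> \<A>"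
    and E: "\<E> \<in> linear_maps \<A> \<B>" and F: "\<F> \<in> linear_maps \<A> \<B>"
  shows "rendered_sot \<Theta> \<A> \<B> (affine_comb \<A> c \<E> \<F>) \<rho> =
    c \<odot>\<^sub>M rendered_sot \<Theta> \<A> \<B> \<E> \<rho> \<oplus>\<^sub>M (1 - c) \<odot>\<^sub>M rendered_sot \<Theta> \<A> \<B> \<F> \<rho>"
proof (rule tensor_element_eqI [of _ \<A> \<B>])
  fix u v assume u: "u \<in> units \<A>" and v: "v \<in> units \<B>"
  let ?S = "\<lambda>\<Phi>. rendered_sot \<Theta> \<A> \<B> \<Phi> \<rho>"
  let ?d = "\<lambda>\<Phi> w. coefficient (\<Phi> (matrix_unit \<A> (swap_unit w))) v"
  let ?t = "\<lambda>w. coefficient (\<Theta> \<A> \<rho> (matrix_unit \<A> w)) u"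
  \<comment> \<open>Stated for every map into \<open>elements \<B>\<close>, so that it covers the
    affine combination as well as \<E> and \<F>.\<close>
  have expand: "coefficient (?S \<Phi>) (pair_unit \<A> \<B> u v) = (\<Sum>w\<in>units \<A>. ?d \<Phi> w * ?t w)"
    if "\<And>A. A \<in> elements \<A> \<Longrightarrow> \<Phi> A \<in> elements \<B>" for \<Phi>
    using u v that
    by (simp add: coefficient_rendered_sot [of \<Theta> \<A> \<rho>, OF T]
        coefficient_linear_map [OF T slice_elements] coefficient_channel_state)
  have "coefficient (?S (affine_comb \<A> c \<E> \<F>)) (pair_unit \<A> \<B> u v) =
      (\<Sum>w\<in>units \<A>. ?d (affine_comb \<A> c \<E> \<F>) w * ?t w)"
    using E F by (intro expand) (simp add: affine_comb_def)
  also have "\<dots> = (\<Sum>w\<in>units \<A>. c * (?d \<E> w * ?t w) + (1 - c) * (?d \<F> w * ?t w))"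
    using E F v
    by (intro sum.cong refl) (simp add: affine_comb_def coefficient_add [of _ \<B>]
        coefficient_scale [of _ \<B>] algebra_simps)
  also have "\<dots> = c * (\<Sum>w\<in>units \<A>. ?d \<E> w * ?t w) + (1 - c) * (\<Sum>w\<in>units \<A>. ?d \<F> w * ?t w)"
    by (simp only: sum.distrib sum_distrib_left)
  also have "\<dots> = c * coefficient (?S \<E>) (pair_unit \<A> \<B> u v) +
      (1 - c) * coefficient (?S \<F>) (pair_unit \<A> \<B> u v)"
    using E F by (simp add: expand)
  also have "\<dots> = coefficient (c \<odot>\<^sub>M ?S \<E> \<oplus>\<^sub>M (1 - c) \<odot>\<^sub>M ?S \<F>) (pair_unit \<A> \<B> u v)"
    using u v by (simp add: coefficient_add [of _ "\<A> \<otimes>\<^sub>A \<B>"]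
        coefficient_scale [of _ "\<A> \<otimes>\<^sub>A \<B>"] pair_unit_units)
  finally show "coefficient (?S (affine_comb \<A> c \<E> \<F>)) (pair_unit \<A> \<B> u v) =
      coefficient (c \<odot>\<^sub>M ?S \<E> \<oplus>\<^sub>M (1 - c) \<odot>\<^sub>M ?S \<F>) (pair_unit \<A> \<B> u v)" .
qed simp_all

text \<open>Commutation with \<open>\<rho> \<otimes>\<^sub>M mm_one \<B>\<close> passes to every
  slice, where the rendering map is multiplication by \<rho>; reassembling the slices gives the
  product.\<close>

lemma rendered_sot_classical:
  assumes T: "\<Theta> \<A> \<rho> \<in> linear_maps \<A> \<A>" and \<rho>: "\<rho> \<in> elements \<A>"
    and T1: "\<And>A. A \<in> elements \<A> \<Longrightarrow> \<rho> \<bullet>\<^sub>M A = A \<bullet>\<^sub>M \<rho> \<Longrightarrow> \<Theta> \<A> \<rho> A = \<rho> \<bullet>\<^sub>M A"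
    and comm: "channel_state \<A> \<B> \<E> \<bullet>\<^sub>M (\<rho> \<otimes>\<^sub>M mm_one \<B>) =
      (\<rho> \<otimes>\<^sub>M mm_one \<B>) \<bullet>\<^sub>M channel_state \<A> \<B> \<E>"
  shows "rendered_sot \<Theta> \<A> \<B> \<E> \<rho> = channel_state \<A> \<B> \<E> \<bullet>\<^sub>M (\<rho> \<otimes>\<^sub>M mm_one \<B>)"
proof (rule tensor_element_eqI [of _ \<A> \<B>])
  let ?D = "channel_state \<A> \<B> \<E>"
  fix u v assume u: "u \<in> units \<A>" and v: "v \<in> units \<B>"
  have right: "slice \<A> \<B> (?D \<bullet>\<^sub>M (\<rho> \<otimes>\<^sub>M mm_one \<B>)) v = slice \<A> \<B> ?D v \<bullet>\<^sub>M \<rho>"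
    using \<rho> v by (simp add: slice_mult_tensor_one_right)
  \<comment> \<open>By \<open>comm\<close> the same slice is also a product with \<rho> on the left;
    comparison with \<open>right\<close> shows that the slice of \<open>?D\<close> commutes with
    \<rho>.\<close>
  moreover have "slice \<A> \<B> (?D \<bullet>\<^sub>M (\<rho> \<otimes>\<^sub>M mm_one \<B>)) v = \<rho> \<bullet>\<^sub>M slice \<A> \<B> ?D v"
    using \<rho> v by (simp add: comm slice_mult_tensor_one_left)
  ultimately have "\<Theta> \<A> \<rho> (slice \<A> \<B> ?D v) = slice \<A> \<B> ?D v \<bullet>\<^sub>M \<rho>"
    using T1 [OF slice_elements] by simp
  then have "coefficient (rendered_sot \<Theta> \<A> \<B> \<E> \<rho>) (pair_unit \<A> \<B> u v) =
      coefficient (slice \<A> \<B> (?D \<bullet>\<^sub>M (\<rho> \<otimes>\<^sub>M mm_one \<B>)) v) u"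
    using u v by (simp only: right coefficient_rendered_sot [of \<Theta> \<A> \<rho>, OF T])
  then show "coefficient (rendered_sot \<Theta> \<A> \<B> \<E> \<rho>) (pair_unit \<A> \<B> u v) =
      coefficient (?D \<bullet>\<^sub>M (\<rho> \<otimes>\<^sub>M mm_one \<B>)) (pair_unit \<A> \<B> u v)"
    using u by simp
qed (use \<rho> in simp_all)

theorem theoremV7:
  fixes \<Theta> :: "algebra \<Rightarrow> element \<Rightarrow> element \<Rightarrow> element"
  assumes "state_rendering_map \<Theta>"
  shows "state_over_time_function (rendered_sot \<Theta>) \<and>
    process_linear (rendered_sot \<Theta>) \<and>
    classical_limit_axiom (rendered_sot \<Theta>)"
proof -
  have T: "\<Theta> \<A> \<rho> \<in> linear_maps \<A> \<A>" and sa: "hs_selfadjoint \<A> (\<Theta> \<A> \<rho>)"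
    if "multi_matrix_algebra \<A>" "\<rho> \<in> states \<A>" for \<A> \<rho>
    using assms that unfolding state_rendering_map_def by blast+
  have T1: "\<Theta> \<A> \<rho> A = \<rho> \<bullet>\<^sub>M A"
    if "multi_matrix_algebra \<A>" "\<rho> \<in> states \<A>" "A \<in> elements \<A>" "\<rho> \<bullet>\<^sub>M A = A \<bullet>\<^sub>M \<rho>" for \<A> \<rho> A
  proof -
    have "mm_commutator \<rho> A = mm_zero \<A>"
      using that by (simp add: mm_commutator_eq_zero_iff)
    then show ?thesis
      using assms that unfolding state_rendering_map_def by blast
  qed
  \<comment> \<open>The unit commutes with every state, so (T1) applies to it; both marginals rest
    on this value.\<close>
  have one: "\<Theta> \<A> \<rho> (mm_one \<A>) = \<rho>"
    if "multi_matrix_algebra \<A>" "\<rho> \<in> states \<A>" for \<A> \<rho>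
    using T1 [OF that, of "mm_one \<A>"] that(2) by (simp add: mm_mult_one_left mm_mult_one_right)
  have "state_over_time_function (rendered_sot \<Theta>)"
    unfolding state_over_time_function_def
    using T sa one
    by (simp add: partial_trace_right_rendered_sot partial_trace_left_rendered_sot)
  moreover have "process_linear (rendered_sot \<Theta>)"
    unfolding process_linear_def using T by (simp add: rendered_sot_affine_comb TP_def)
  moreover have "classical_limit_axiom (rendered_sot \<Theta>)"
    unfolding classical_limit_axiom_def
  proof (intro allI impI, elim conjE)
    fix \<A> \<B> \<E> \<rho>
    assume A: "multi_matrix_algebra \<A>" and \<rho>: "\<rho> \<in> states \<A>"
      and "mm_commutator (channel_state \<A> \<B> \<E>) (\<rho> \<otimes>\<^sub>M mm_one \<B>) = mm_zero (\<A> \<otimes>\<^sub>A \<B>)"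
    then have "channel_state \<A> \<B> \<E> \<bullet>\<^sub>M (\<rho> \<otimes>\<^sub>M mm_one \<B>) =
        (\<rho> \<otimes>\<^sub>M mm_one \<B>) \<bullet>\<^sub>M channel_state \<A> \<B> \<E>"
      by (simp add: mm_commutator_eq_zero_iff [of _ "\<A> \<otimes>\<^sub>A \<B>"])
    then show "rendered_sot \<Theta> \<A> \<B> \<E> \<rho> = channel_state \<A> \<B> \<E> \<bullet>\<^sub>M (\<rho> \<otimes>\<^sub>M mm_one \<B>)"
      by (intro rendered_sot_classical T [OF A \<rho>] T1 [OF A \<rho>] states_elements [OF \<rho>])
  qed
  ultimately show ?thesis
    by blast
qed

end
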